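(* Let $\bm C\in\mathbb S^d_{++}$, $\bm a_1,\dots,\bm a_n\in\mathbb R^d$, $s\in[n]$, and $z^*:=\max_{S\subseteq[n],|S|=s}\log\det(\bm C+\sum_{i\in S}\bm a_i\bm a_i^\top)$. Let $S^1,S^0\subseteq[n]$ be disjoint sets with $|S^1|\le s$. If $z(S^1,S^0)<z^*$, then at least one of the two inequalities $$\sum_{i\in S^1}x_i\le|S^1|-1,\qquad \sum_{j\in S^0}x_j\ge1\qquad(\bm x\in\mathcal Z_s)$$ is an optimality cut for the problem of maximizing $\log\det(\bm C+\sum_{i\in[n]}x_i\bm a_i\bm a_i^\top)$ over $\bm x\in\mathcal Z_s$.
   Context: $[n]=\{1,\dots,n\}$; $\mathbb S^d_{++}$ is the set of symmetric positive-definite $d\times d$ matrices; $\mathcal Z_s:=\{\bm x\in\{0,1\}^n:\sum_i x_i=s\}$, where $\bm x$ is the characteristic vector of the selected set $S$. The restricted problem, in which the points in $S^1$ are forced to be selected and those in $S^0$ are forced to be discarded, has value $$z(S^1,S^0):=\max_{S\subseteq[n]\setminus(S^1\cup S^0),\ |S|=s-|S^1|}\ \log\det\Big(\bm C+\sum_{i\in S^1}\bm a_i\bm a_i^\top+\sum_{i\in S}\bm a_i\bm a_i^\top\Big)$$ (with value $-\infty$ if there is no feasible $S$). An optimality cut is an inequality that can be imposed on $\bm x\in\mathcal Z_s$ without changing the optimal value $z^*$, i.e. an inequality satisfied by at least one optimal solution. Empty sums are $0$. *)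

theory Defs
  imports "HOL-Analysis.Analysis"
begin

definition sym_pos_def :: "real^'d^'d \<Rightarrow> bool" where
  "sym_pos_def A \<longleftrightarrow> transpose A = A \<and> (\<forall>v. v \<noteq> 0 \<longrightarrow> v \<bullet> (A *v v) > 0)"

text \<open>The matrix \<open>v v\<^sup>T\<close>.\<close>

definition outer :: "real^'d \<Rightarrow> real^'d^'d" where
  "outer v = (\<chi> i j. v $ i * v $ j)"

text \<open>
  Optimal value of maximizing \<open>f\<close> over the feasible set \<open>X\<close>. All feasible sets below are
  finite, so the supremum is attained unless \<open>X\<close> is empty, in which case it is \<open>-\<infinity>\<close>.
\<close>

definition max_value :: "('b \<Rightarrow> real) \<Rightarrow> 'b set \<Rightarrow> ereal" where
  "max_value f X = (SUP x\<in>X. ereal (f x))"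

text \<open>
  The index set \<open>{1,...,n}\<close> is the finite type \<open>'n\<close>, so \<open>n = CARD('n)\<close>.
\<close>

definition opt_value :: "real^'d^'d \<Rightarrow> ('n::finite \<Rightarrow> real^'d) \<Rightarrow> nat \<Rightarrow> ereal" where
  "opt_value C a s =
     max_value (\<lambda>S. ln (det (C + (\<Sum>i\<in>S. outer (a i))))) {S. card S = s}"

text \<open>
  The cardinality constraint \<open>|S| = s - |S1|\<close> is written additively to avoid truncated
  subtraction.
\<close>

definition restricted_value ::
    "real^'d^'d \<Rightarrow> ('n::finite \<Rightarrow> real^'d) \<Rightarrow> nat \<Rightarrow> 'n set \<Rightarrow> 'n set \<Rightarrow> ereal" where
  "restricted_value C a s S1 S0 =
     max_value (\<lambda>S. ln (det (C + (\<Sum>i\<in>S1. outer (a i)) + (\<Sum>i\<in>S. outer (a i)))))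
       {S. S \<subseteq> UNIV - (S1 \<union> S0) \<and> card S1 + card S = s}"

definition Z_set :: "nat \<Rightarrow> (real^'n) set" where
  "Z_set s = {x. (\<forall>i. x $ i \<in> {0, 1}) \<and> (\<Sum>i\<in>UNIV. x $ i) = real s}"

definition logdet_obj :: "real^'d^'d \<Rightarrow> ('n::finite \<Rightarrow> real^'d) \<Rightarrow> real^'n \<Rightarrow> real" where
  "logdet_obj C a x = ln (det (C + (\<Sum>i\<in>UNIV. (x $ i) *\<^sub>R outer (a i))))"

text \<open>
  For the problem of maximizing \<open>f\<close> over \<open>X\<close>, an inequality, given as the predicate \<open>P\<close> that it
  imposes on \<open>x\<close>, is an optimality cut if imposing it leaves the optimal value unchanged.
\<close>

definition optimality_cut :: "('b \<Rightarrow> real) \<Rightarrow> 'b set \<Rightarrow> ('b \<Rightarrow> bool) \<Rightarrow> bool" where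
  "optimality_cut f X P \<longleftrightarrow> max_value f {x \<in> X. P x} = max_value f X"

lemma max_value_attained:
  assumes "finite X" "X \<noteq> {}"
  obtains x where "x \<in> X" "max_value f X = ereal (f x)"
proof -
  have "max_value f X = Max ((\<lambda>x. ereal (f x)) ` X)"
    unfolding max_value_def using assms by (simp add: Max_Sup)
  also have "\<dots> \<in> (\<lambda>x. ereal (f x)) ` X"
    using assms by (intro Max_in) auto
  finally show ?thesis using that by auto
qed

lemma finite_Z_set: "finite (Z_set s :: (real^'n) set)"
proof (rule finite_subset)
  show "(Z_set s :: (real^'n) set) \<subseteq> vec_lambda ` (UNIV \<rightarrow>\<^sub>E {0, 1})"
  proof
    fix x :: "real^'n" assume "x \<in> Z_set s"
    then have "($) x \<in> UNIV \<rightarrow>\<^sub>E {0, 1}" by (auto simp: Z_set_def)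
    moreover have "x = vec_lambda (($) x)" by simp
    ultimately show "x \<in> vec_lambda ` (UNIV \<rightarrow>\<^sub>E {0, 1})" by blast
  qed
  show "finite (vec_lambda ` (UNIV \<rightarrow>\<^sub>E {0, 1}) :: (real^'n) set)"
    by (intro finite_imageI finite_PiE) auto
qed

text \<open>Equivalently, an optimality cut is satisfied by at least one optimal solution.\<close>

lemma optimality_cut_iff:
  assumes "finite X" "X \<noteq> {}"
  shows "optimality_cut f X P \<longleftrightarrow> (\<exists>x\<in>X. P x \<and> (\<forall>y\<in>X. f y \<le> f x))"
proof
  assume cut: "optimality_cut f X P"
  have fin: "finite {x \<in> X. P x}" using assms by simp
  obtain x0 where x0: "x0 \<in> X" "max_value f X = ereal (f x0)"
    using max_value_attained[OF assms] by blast
  have ne: "{x \<in> X. P x} \<noteq> {}"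
  proof
    assume "{x \<in> X. P x} = {}"
    then have "max_value f {x \<in> X. P x} = -\<infinity>"
      by (simp only: max_value_def image_empty Sup_empty bot_ereal_def)
    then show False using cut x0 by (simp add: optimality_cut_def)
  qed
  obtain x where x: "x \<in> X" "P x" "max_value f {x \<in> X. P x} = ereal (f x)"
    using max_value_attained[OF fin ne] by blast
  have "f y \<le> f x" if "y \<in> X" for y
  proof -
    have "ereal (f y) \<le> max_value f X"
      unfolding max_value_def using that by (rule SUP_upper)
    also have "\<dots> = ereal (f x)" using cut x by (simp add: optimality_cut_def)
    finally show ?thesis by simp
  qed
  then show "\<exists>x\<in>X. P x \<and> (\<forall>y\<in>X. f y \<le> f x)" using x by blast
next
  assume "\<exists>x\<in>X. P x \<and> (\<forall>y\<in>X. f y \<le> f x)"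
  then obtain x where x: "x \<in> X" "P x" "\<forall>y\<in>X. f y \<le> f x" by blast
  have "max_value f X \<le> ereal (f x)"
    unfolding max_value_def using x by (intro SUP_least) auto
  also have "\<dots> \<le> max_value f {x \<in> X. P x}"
    unfolding max_value_def using x by (intro SUP_upper) auto
  finally have "max_value f X \<le> max_value f {x \<in> X. P x}" .
  moreover have "max_value f {x \<in> X. P x} \<le> max_value f X"
    unfolding max_value_def by (intro SUP_subset_mono) auto
  ultimately show "optimality_cut f X P" by (simp add: optimality_cut_def)
qed

end

theory Submission
  imports Defs
begin

text \<open>
  Take an optimal set \<open>T\<close>. Its characteristic vector satisfies the first inequality unless
  \<open>S1 \<subseteq> T\<close> and the second one unless \<open>T\<close> avoids \<open>S0\<close>. If it violated both, then \<open>T - S1\<close> would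
  be feasible for the restricted problem and would attain the unrestricted optimum there.
\<close>

definition char_vec :: "'n set \<Rightarrow> real^'n" where
  "char_vec T = (\<chi> i. of_bool (i \<in> T))"

lemma sum_char_vec:
  fixes T A :: "'n::finite set"
  shows "(\<Sum>i\<in>A. char_vec T $ i) = real (card (A \<inter> T))"
  by (simp add: char_vec_def of_bool_def sum.If_cases)

text \<open>A 0/1 vector is determined by where its ones sit, and its coordinate sum counts them.
  This is the bridge between vectors and subsets.\<close>

lemma Z_set_eq_char_vec: "Z_set s = char_vec ` {T :: 'n::finite set. card T = s}"
proof (intro equalityI subsetI)
  fix x :: "real^'n" assume x: "x \<in> Z_set s"
  have eq: "x = char_vec {i. x $ i = 1}"
    using x by (auto simp: Z_set_def char_vec_def vec_eq_iff)
  have "real (card {i. x $ i = 1}) = (\<Sum>i\<in>UNIV. x $ i)"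
    \<comment> \<open>Only the \<open>x\<close> in the sum is rewritten; the one inside the set of
      ones must stay.\<close>
    by (subst (2) eq) (simp only: sum_char_vec Int_UNIV_left)
  then show "x \<in> char_vec ` {T. card T = s}"
    using x eq by (auto simp: Z_set_def)
next
  fix x :: "real^'n" assume "x \<in> char_vec ` {T. card T = s}"
  then obtain T :: "'n set" where T: "card T = s" "x = char_vec T" by auto
  show "x \<in> Z_set s"
    unfolding Z_set_def T(2) using T(1) by (simp add: sum_char_vec) (simp add: char_vec_def)
qed

lemma logdet_obj_char_vec:
  "logdet_obj C a (char_vec T) = ln (det (C + (\<Sum>i\<in>T. outer (a i))))"
proof -
  have "(\<Sum>i\<in>UNIV. (char_vec T $ i) *\<^sub>R outer (a i)) = (\<Sum>i\<in>T. outer (a i))"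
    by (rule sum.mono_neutral_cong_right) (auto simp: char_vec_def)
  then show ?thesis by (simp add: logdet_obj_def)
qed

text \<open>The bound on \<open>s\<close> guarantees a subset of size \<open>s\<close>, so the value
  is a genuine maximum and not -\<infinity>.\<close>

lemma opt_value_attained:
  fixes a :: "'n::finite \<Rightarrow> real^'d"
  assumes "s \<le> CARD('n)"
  obtains T where "card T = s" "opt_value C a s = ereal (logdet_obj C a (char_vec T))"
proof -
  obtain T0 :: "'n set" where "card T0 = s"
    using obtain_subset_with_card_n[OF assms] by blast
  then have ne: "{T :: 'n set. card T = s} \<noteq> {}" by blast
  show ?thesis
    using max_value_attained[OF _ ne, of "\<lambda>S. ln (det (C + (\<Sum>i\<in>S. outer (a i))))"] that
    by (auto simp: opt_value_def logdet_obj_char_vec)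
qed

text \<open>The hypothesis speaks of subsets, the cuts of vectors; this lets one optimum serve
  both.\<close>

lemma max_value_Z_set: "max_value (logdet_obj C a) (Z_set s) = opt_value C a s"
  by (simp add: opt_value_def max_value_def Z_set_eq_char_vec image_image logdet_obj_char_vec)

text \<open>Shrinking the feasible set cannot raise the value, and a surviving maximizer keeps it
  from dropping.\<close>

lemma optimality_cutI:
  assumes "x \<in> X" "P x" "max_value f X = ereal (f x)"
  shows "optimality_cut f X P"
  unfolding optimality_cut_def
proof (rule antisym)
  show "max_value f {x \<in> X. P x} \<le> max_value f X"
    unfolding max_value_def by (intro SUP_subset_mono) auto
  show "max_value f X \<le> max_value f {x \<in> X. P x}"
    unfolding assms(3) using assms(1,2) by (auto simp: max_value_def intro: SUP_upper)
qed

lemma restricted_value_ge: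
  assumes "S1 \<subseteq> T" "T \<inter> S0 = {}" "card T = s"
  shows "ereal (logdet_obj C a (char_vec T)) \<le> restricted_value C a s S1 S0"
proof -
  let ?f = "\<lambda>S. ln (det (C + (\<Sum>i\<in>S1. outer (a i)) + (\<Sum>i\<in>S. outer (a i))))"
  have "(\<Sum>i\<in>T. outer (a i)) = (\<Sum>i\<in>S1. outer (a i)) + (\<Sum>i\<in>T - S1. outer (a i))"
    using assms(1) by (metis finite add.commute sum.subset_diff)
  then have "logdet_obj C a (char_vec T) = ?f (T - S1)"
    by (simp add: logdet_obj_char_vec add.assoc)
  moreover have "card S1 + card (T - S1) = s"
    \<comment> \<open>\<open>card S1 \<le> card T\<close> makes the natural-number subtraction in
      \<open>card_Diff_subset\<close> exact.\<close>
    using assms(1,3) card_mono[OF _ assms(1)] by (simp add: card_Diff_subset)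
  ultimately show ?thesis
    unfolding restricted_value_def max_value_def using assms(2)
    by (auto intro!: SUP_upper2[of "T - S1"])
qed

theorem theorem18:
  fixes C :: "real^'d^'d"
    and a :: "'n::finite \<Rightarrow> real^'d"
    and s :: nat
    and S1 S0 :: "'n set"
  assumes "sym_pos_def C"
    and "1 \<le> s" and "s \<le> CARD('n)"
    and "S1 \<inter> S0 = {}"
    and "card S1 \<le> s"
    and "restricted_value C a s S1 S0 < opt_value C a s"
  shows "optimality_cut (logdet_obj C a) (Z_set s)
           (\<lambda>x. (\<Sum>i\<in>S1. x $ i) \<le> real (card S1) - 1)
       \<or> optimality_cut (logdet_obj C a) (Z_set s)
           (\<lambda>x. (\<Sum>j\<in>S0. x $ j) \<ge> 1)"
proof -
  obtain T :: "'n set"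
    where T: "card T = s" "opt_value C a s = ereal (logdet_obj C a (char_vec T))"
    using opt_value_attained[OF assms(3)] by blast
  have Z: "char_vec T \<in> Z_set s"
    using T(1) by (simp add: Z_set_eq_char_vec)
  have cut: "optimality_cut (logdet_obj C a) (Z_set s) P" if "P (char_vec T)" for P
    using optimality_cutI[of _ _ P, OF Z that] T(2) by (simp add: max_value_Z_set)
  \<comment> \<open>Otherwise the restricted value would reach the optimum, against the strict
    gap.\<close>
  have "\<not> (S1 \<subseteq> T \<and> T \<inter> S0 = {})"
    using restricted_value_ge[of S1 T S0 s C a] T assms(6) by auto
  then consider "S1 \<inter> T \<subset> S1" | "S0 \<inter> T \<noteq> {}" by blast
  then show ?thesis
  proof cases
    case 1
    \<comment> \<open>\<open>T\<close> misses a point of \<open>S1\<close>; since cardinalities are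
      integers, the strict bound gives the \<open>- 1\<close> on the right-hand side.\<close>
    then have "card (S1 \<inter> T) < card S1"
      by (intro psubset_card_mono) auto
    then show ?thesis
      by (intro disjI1 cut) (simp add: sum_char_vec)
  next
    case 2
    then have "card (S0 \<inter> T) \<ge> 1"
      by (simp add: Suc_le_eq card_gt_0_iff)
    then show ?thesis
      by (intro disjI2 cut) (simp add: sum_char_vec)
  qed
qed

end
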